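(* Let $G=(V,E)$ be an Eulerian multigraph with a rooted tree decomposition $(\{X(j)\}_{j\in I},T=(I,F))$, and let $i\in I$ be a forget node: $i$ has a single child $i'$ and $X(i)=X(i')\setminus\{w\}$ for some $w\in X(i')$. Let $\mathcal{D}$ be an orientation of the edges of $G_\ell(i)$, let $\mathcal{F}$ be a set of arcs of $\mathcal{D}$, and let $c\in\mathbb{Z}^{X(i)}$. Then $(\mathcal{D},\mathcal{F})\in FOR(i)$ with $c(\mathcal{D})=c$ if and only if $\mathcal{D}$ is the disjoint union of some $\mathcal{D}'\in D_\ell(i')$ and some orientation $Q$ of $E(i',w)$ (with induced values $q_{w,x}$, $x\in X(i)$), and $\mathcal{F}$ is the disjoint union of some $\mathcal{F}'\in FOR(\mathcal{D}')$ and some arc set $\mathcal{Q}\subseteq Q$, such that all of the following hold, where $R=\{x\in L(i): s(\mathcal{F})_x=x\}$ and $R'=\{x\in L(i'): s(\mathcal{F}')_x=x\}$: (a) $(\mathcal{D}',\mathcal{F}')\in FOR(i')$; (b) $\sum_{x\in X(i)}(m_{w,x}-2q_{w,x})=c(\mathcal{D}')_w$; (c) $c_x=c(\mathcal{D}')_x$ for $x\in X(i)\setminus A_w$, and $c_x=c(\mathcal{D}')_x-2q_{w,x}+m_{w,x}$ for $x\in X(i)\cap A_w$; (d) one of the following holds: - Case $w\notin R'$: $R=(R'\setminus L)\cup U$ for some sets $L,U$ with (i) $L\subseteq \big(R'\cap\{x\in A_w: q_{w,x}<m_{w,x}\}\big)\setminus\{s(\mathcal{F}')_w\}$ and (ii)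 $U(i')\cap\{x\in A_w: q_{w,x}=m_{w,x}\}\subseteq U\subseteq U(i')\cap A_w$; and $\mathcal{Q}$ consists of exactly one arc of the form $(x\to w)$ (one of the $m_{w,x}-q_{w,x}$ edges of $E_{w,x}$ oriented towards $w$ in $Q$) for every $x\in L\cup\big((A_w\cap U(i'))\setminus U\big)$, and no other arcs. - Case $w\in R'$: $R=\big(R'\setminus(L\cup\{w\})\big)\cup U\cup(\{w^*\}\cap U(i'))$ for some vertex $w^*$ and sets $L,U$ with (I) $w^*\in \big(X(i)\cap\{x\in A_w: q_{w,x}>0\}\big)\setminus\{x\in L(i'): s(\mathcal{F}')_x=w\}$, (II) $L\subseteq\big(R'\cap\{x\in A_w: q_{w,x}<m_{w,x}\}\big)\setminus\{w,w^*,s(\mathcal{F}')_{w^*}\}$, and (III) $U(i')\cap\{x\in A_w: q_{w,x}=m_{w,x}\}\subseteq U\subseteq U(i')\cap A_w$; and $\mathcal{Q}$ consists of exactly one arc of the form $(x\to w)$ for every $x\in L\cup\big((A_w\cap U(i'))\setminus(U\cup\{w^*\})\big)$, together with exactly one arc of the form $(w\to w^* )$, and no other arcs.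
   Context: $G=(V,E)$ is a connected multigraph in which every vertex has even degree. $(\{X(j)\}_{j\in I},T=(I,F))$ is a tree decomposition of $G$ (a tree $T$ with bags $X(j)\subseteq V$ covering $V$, every edge inside some bag, and the bags containing any fixed vertex forming a subtree), with $T$ rooted at some node. For $j\in I$: $V(j)$ is the union of the bags $X(l)$ over all nodes $l$ in the subtree of $T$ rooted at $j$; $E_\ell(j)$ is the set of edges of $G$ with both endpoints in $V(j)$ and at most one endpoint in $X(j)$; $G_\ell(j)$ is the graph formed by the edges $E_\ell(j)$; $L(j)$ is the set of $x\in X(j)$ incident to some edge of $E_\ell(j)$, and $U(j)=X(j)\setminus L(j)$. $D_\ell(j)$ is the set of orientations of the edges of $E_\ell(j)$ in which every vertex of $V(j)\setminus X(j)$ has equal in- and out-degree. For an orientation $\mathcal{D}$ of $E_\ell(j)$, its charge vector $c(\mathcal{D})\in\mathbb{Z}^{X(j)}$ has $c(\mathcal{D})_x$ = (out-degree minus in-degree of $x$ in $\mathcal{D}$) (so it is $0$ on $U(j)$). For $\mathcal{D}\in D_\ell(j)$, $FOR(\mathcal{D})$ is the set of arc sets $\mathcal{F}\subseteq\mathcal{D}$ forming an in-directed forest (each vertex has at most one out-arc in $\mathcal{F}$ and there is no directed cycle) whose set of roots $R(\mathcal{F})$ (vertices without out-arc in $\mathcal{F}$ among $(V(j)\setminus X(j))\cup L(j)$) is contained in $L(j)$, i.e. every $v\in (V(j)\setminus X(j))\cup(L(j)\setminus R(\mathcal{F}))$ has exactly one out-arc in $\mathcal{F}$. The root vector $s(\mathcal{F})\in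 X(j)^{X(j)}$ is given by $s(\mathcal{F})_x$ = the root of the tree of $\mathcal{F}$ containing $x$ for $x\in L(j)$, and $s(\mathcal{F})_x=x$ for $x\in U(j)$. A forest Orb at node $j$ is a pair $(\mathcal{D},\mathcal{F})$ with $\mathcal{D}\in D_\ell(j)$ and $\mathcal{F}\in FOR(\mathcal{D})$; $FOR(j)$ is the set of forest Orbs at $j$. For vertices $u,v$, $E_{u,v}$ is the set of edges between $u$ and $v$ and $m_{u,v}=|E_{u,v}|$. $A_w$ is the set of vertices adjacent to $w$ in $G$. $E(i',w)=\bigcup_{x\in X(i)}E_{w,x}$. For an orientation $Q$ of $E(i',w)$, $q_{w,x}$ is the number of edges of $E_{w,x}$ oriented away from $w$ in $Q$.
   Formalization: In (d) the cases are w∉R'∪U(i') and w∈R'∪U(i') instead of w∉R' and w∈R'; as written the claim fails when w∈U(i'), e.g. for a triangle with X(i)={a,b}, w=c, since w then needs an out-arc. Multigraphs are taken finite and loopless. *)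

theory Defs
  imports Main
begin

text \<open>
  Multigraphs are finite, undirected and loopless: an edge has exactly two distinct ends,
  and different edges may have the same ends.
\<close>

record ('v, 'e) multigraph =
  vertices :: "'v set"
  edges :: "'e set"
  ends :: "'e \<Rightarrow> 'v set"

definition wf_multigraph :: "('v, 'e) multigraph \<Rightarrow> bool" where
  "wf_multigraph G \<longleftrightarrow>
     finite (vertices G) \<and> finite (edges G) \<and>
     (\<forall>e\<in>edges G. ends G e \<subseteq> vertices G \<and> card (ends G e) = 2)"

definition degree :: "('v, 'e) multigraph \<Rightarrow> 'v \<Rightarrow> nat" where
  "degree G v = card {e \<in> edges G. v \<in> ends G e}"

definition edges_between :: "('v, 'e) multigraph \<Rightarrow> 'v \<Rightarrow> 'v \<Rightarrow> 'e set" where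
  "edges_between G u v = {e \<in> edges G. ends G e = {u, v}}"

definition edge_mult :: "('v, 'e) multigraph \<Rightarrow> 'v \<Rightarrow> 'v \<Rightarrow> nat" where
  "edge_mult G u v = card (edges_between G u v)"

definition neighbours :: "('v, 'e) multigraph \<Rightarrow> 'v \<Rightarrow> 'v set" where
  "neighbours G w = {x. edges_between G w x \<noteq> {}}"

definition edges_to :: "('v, 'e) multigraph \<Rightarrow> 'v \<Rightarrow> 'v set \<Rightarrow> 'e set" where
  "edges_to G w S = (\<Union>x\<in>S. edges_between G w x)"

definition connected_on :: "'a set \<Rightarrow> ('a \<times> 'a) set \<Rightarrow> bool" where
  "connected_on S R \<longleftrightarrow> S \<noteq> {} \<and> (\<forall>u\<in>S. \<forall>v\<in>S. (u, v) \<in> (R \<inter> S \<times> S)\<^sup>*)"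

definition eulerian :: "('v, 'e) multigraph \<Rightarrow> bool" where
  "eulerian G \<longleftrightarrow>
     wf_multigraph G \<and>
     connected_on (vertices G) {(u, v). v \<in> neighbours G u} \<and>
     (\<forall>v\<in>vertices G. even (degree G v))"


section \<open>Rooted tree decompositions\<close>

definition simple_path :: "'i set set \<Rightarrow> 'i list \<Rightarrow> bool" where
  "simple_path F p \<longleftrightarrow> p \<noteq> [] \<and> distinct p \<and> successively (\<lambda>j k. {j, k} \<in> F) p"

definition is_tree :: "'i set \<Rightarrow> 'i set set \<Rightarrow> bool" where
  "is_tree I F \<longleftrightarrow>
     finite I \<and> (\<forall>f\<in>F. f \<subseteq> I \<and> card f = 2) \<and>
     connected_on I {(j, k). {j, k} \<in> F} \<and>
     \<not> (\<exists>p. simple_path F p \<and> length p \<ge> 3 \<and> {last p, hd p} \<in> F)"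

record ('i, 'v) rooted_decomp =
  nodes :: "'i set"
  tree_edges :: "'i set set"
  root :: 'i
  bag :: "'i \<Rightarrow> 'v set"

definition rooted_tree_decomposition ::
    "('v, 'e) multigraph \<Rightarrow> ('i, 'v) rooted_decomp \<Rightarrow> bool" where
  "rooted_tree_decomposition G T \<longleftrightarrow>
     is_tree (nodes T) (tree_edges T) \<and> root T \<in> nodes T \<and>
     (\<Union>j\<in>nodes T. bag T j) = vertices G \<and>
     (\<forall>e\<in>edges G. \<exists>j\<in>nodes T. ends G e \<subseteq> bag T j) \<and>
     (\<forall>v\<in>vertices G. connected_on {j \<in> nodes T. v \<in> bag T j} {(j, k). {j, k} \<in> tree_edges T})"

definition subtree_nodes :: "('i, 'v) rooted_decomp \<Rightarrow> 'i \<Rightarrow> 'i set" where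
  "subtree_nodes T j =
     {l \<in> nodes T. \<exists>p. simple_path (tree_edges T) p \<and> hd p = root T \<and> last p = l \<and> j \<in> set p}"

definition children :: "('i, 'v) rooted_decomp \<Rightarrow> 'i \<Rightarrow> 'i set" where
  "children T j = {k \<in> subtree_nodes T j. {j, k} \<in> tree_edges T}"

definition forget_node :: "('i, 'v) rooted_decomp \<Rightarrow> 'i \<Rightarrow> 'i \<Rightarrow> 'v \<Rightarrow> bool" where
  "forget_node T i i' w \<longleftrightarrow>
     i \<in> nodes T \<and> children T i = {i'} \<and> w \<in> bag T i' \<and> bag T i = bag T i' - {w}"

definition lower_vertices :: "('i, 'v) rooted_decomp \<Rightarrow> 'i \<Rightarrow> 'v set" where
  "lower_vertices T j = (\<Union>l\<in>subtree_nodes T j. bag T l)"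

definition lower_edges :: "('v, 'e) multigraph \<Rightarrow> ('i, 'v) rooted_decomp \<Rightarrow> 'i \<Rightarrow> 'e set" where
  "lower_edges G T j =
     {e \<in> edges G. ends G e \<subseteq> lower_vertices T j \<and> card (ends G e \<inter> bag T j) \<le> 1}"

definition L_set :: "('v, 'e) multigraph \<Rightarrow> ('i, 'v) rooted_decomp \<Rightarrow> 'i \<Rightarrow> 'v set" where
  "L_set G T j = {x \<in> bag T j. \<exists>e\<in>lower_edges G T j. x \<in> ends G e}"

definition U_set :: "('v, 'e) multigraph \<Rightarrow> ('i, 'v) rooted_decomp \<Rightarrow> 'i \<Rightarrow> 'v set" where
  "U_set G T j = bag T j - L_set G T j"


section \<open>Orientations\<close>

text \<open>An arc \<open>(e, u, v)\<close> is the edge \<open>e\<close> directed from \<open>u\<close> to \<open>v\<close>.\<close>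

type_synonym ('v, 'e) arc = "'e \<times> 'v \<times> 'v"

abbreviation arc_tail :: "('v, 'e) arc \<Rightarrow> 'v" where
  "arc_tail a \<equiv> fst (snd a)"

abbreviation arc_head :: "('v, 'e) arc \<Rightarrow> 'v" where
  "arc_head a \<equiv> snd (snd a)"

definition orientations :: "('v, 'e) multigraph \<Rightarrow> 'e set \<Rightarrow> ('v, 'e) arc set set" where
  "orientations G S =
     {D. (\<forall>(e, u, v)\<in>D. e \<in> S \<and> ends G e = {u, v}) \<and> (\<forall>e\<in>S. \<exists>!a. a \<in> D \<and> fst a = e)}"

definition outdeg :: "('v, 'e) arc set \<Rightarrow> 'v \<Rightarrow> nat" where
  "outdeg D x = card {a \<in> D. arc_tail a = x}"

definition indeg :: "('v, 'e) arc set \<Rightarrow> 'v \<Rightarrow> nat" where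
  "indeg D x = card {a \<in> D. arc_head a = x}"

definition charge :: "('v, 'e) arc set \<Rightarrow> 'v \<Rightarrow> int" where
  "charge D x = int (outdeg D x) - int (indeg D x)"

definition out_mult :: "('v, 'e) arc set \<Rightarrow> 'v \<Rightarrow> 'v \<Rightarrow> nat" where
  "out_mult Q w x = card {a \<in> Q. arc_tail a = w \<and> arc_head a = x}"

definition balanced_orientations ::
    "('v, 'e) multigraph \<Rightarrow> ('i, 'v) rooted_decomp \<Rightarrow> 'i \<Rightarrow> ('v, 'e) arc set set" where
  "balanced_orientations G T j =
     {D \<in> orientations G (lower_edges G T j).
        \<forall>v \<in> lower_vertices T j - bag T j. outdeg D v = indeg D v}"


section \<open>Forest Orbs\<close>

definition arc_rel :: "('v, 'e) arc set \<Rightarrow> ('v \<times> 'v) set" where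
  "arc_rel F = {(u, v). \<exists>e. (e, u, v) \<in> F}"

definition in_forest :: "('v, 'e) arc set \<Rightarrow> bool" where
  "in_forest F \<longleftrightarrow> (\<forall>v. \<exists>\<^sub>\<le>\<^sub>1 a. a \<in> F \<and> arc_tail a = v) \<and> acyclic (arc_rel F)"

definition forest_roots ::
    "('v, 'e) multigraph \<Rightarrow> ('i, 'v) rooted_decomp \<Rightarrow> 'i \<Rightarrow> ('v, 'e) arc set \<Rightarrow> 'v set" where
  "forest_roots G T j F =
     {v \<in> (lower_vertices T j - bag T j) \<union> L_set G T j. \<not> (\<exists>a\<in>F. arc_tail a = v)}"

definition FOR_in ::
    "('v, 'e) multigraph \<Rightarrow> ('i, 'v) rooted_decomp \<Rightarrow> 'i \<Rightarrow> ('v, 'e) arc set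
       \<Rightarrow> ('v, 'e) arc set set" where
  "FOR_in G T j D = {F. F \<subseteq> D \<and> in_forest F \<and> forest_roots G T j F \<subseteq> L_set G T j}"

definition forest_orbs ::
    "('v, 'e) multigraph \<Rightarrow> ('i, 'v) rooted_decomp \<Rightarrow> 'i
       \<Rightarrow> (('v, 'e) arc set \<times> ('v, 'e) arc set) set" where
  "forest_orbs G T j = {(D, F). D \<in> balanced_orientations G T j \<and> F \<in> FOR_in G T j D}"

text \<open>
  The root of the tree of \<open>F\<close> containing \<open>x\<close> is the vertex without out-arc reached from \<open>x\<close>;
  it is unique when \<open>F\<close> is a finite in-directed forest.
\<close>

definition root_vector ::
    "('v, 'e) multigraph \<Rightarrow> ('i, 'v) rooted_decomp \<Rightarrow> 'i \<Rightarrow> ('v, 'e) arc set \<Rightarrow> 'v \<Rightarrow> 'v" where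
  "root_vector G T j F x =
     (if x \<in> L_set G T j
      then (THE r. (x, r) \<in> (arc_rel F)\<^sup>* \<and> \<not> (\<exists>a\<in>F. arc_tail a = r))
      else x)"

text \<open>
  A bag vertex \<open>x\<close> outside \<open>L_set G T j\<close> lies on no edge of \<open>lower_edges G T j\<close>; it satisfies
  \<open>root_vector G T j F x = x\<close> and has no out-arc, but it does not belong to \<open>fixed_roots\<close>.
  Hence the bag vertices that are their own root are those in \<open>fixed_roots G T j F \<union> U_set G T j\<close>.
\<close>

definition fixed_roots ::
    "('v, 'e) multigraph \<Rightarrow> ('i, 'v) rooted_decomp \<Rightarrow> 'i \<Rightarrow> ('v, 'e) arc set \<Rightarrow> 'v set" where
  "fixed_roots G T j F = {x \<in> L_set G T j. root_vector G T j F x = x}"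

definition one_arc_per :: "('v, 'e) arc set \<Rightarrow> ('v \<times> 'v) set \<Rightarrow> bool" where
  "one_arc_per A P \<longleftrightarrow>
     (\<forall>(u, v)\<in>P. \<exists>!a. a \<in> A \<and> arc_tail a = u \<and> arc_head a = v) \<and>
     (\<forall>a\<in>A. (arc_tail a, arc_head a) \<in> P)"

end

theory Submission
  imports Defs
begin

text \<open>
  Forgetting \<open>w\<close> leaves the lower vertices unchanged and adds to the lower edges exactly those
  joining \<open>w\<close> to the remaining bag, so an orientation splits uniquely into \<open>D'\<close> and a star \<open>Q\<close>
  at \<open>w\<close>; the charge conditions are additivity of the charge.
  A set of arcs becomes an in-forest after adding star arcs iff no vertex gets two out-arcs and no
  cycle through \<open>w\<close> arises. From \<open>w\<close> (or from \<open>w'\<close>, if \<open>w\<close> is a root and receives the arc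
  to \<open>w'\<close>) the old forest leads to a single root, so it suffices that this root gets no
  out-arc and is not \<open>w\<close>. The sets \<open>L\<close> and \<open>U\<close> record which old roots gain and which
  formerly untouched bag vertices do not gain an out-arc.
\<close>

section \<open>The subtree below a forget node\<close>

text \<open>The node following \<open>i\<close> on a root path to \<open>l\<close> is the wanted
  child: the prefix ending there puts it below \<open>i\<close>, and the whole path puts
  \<open>l\<close> below it.\<close>

lemma subtree_nodes_via_child:
  assumes "\<Union>(tree_edges T) \<subseteq> nodes T" "l \<in> subtree_nodes T i" "l \<noteq> i"
  obtains k where "k \<in> children T i" "l \<in> subtree_nodes T k"
proof -
  from assms obtain p where p: "simple_path (tree_edges T) p" "hd p = root T" "last p = l" "i \<in> set p"
    and l: "l \<in> nodes T"
    by (auto simp: subtree_nodes_def)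
  from p(4) obtain a b where ab: "p = a @ i # b" by (auto dest: split_list)
  with p(3) assms(3) obtain k b' where b: "b = k # b'" by (cases b) auto
  have e: "{i, k} \<in> tree_edges T"
    using p(1) by (auto simp: simple_path_def ab b successively_append_iff)
  have "simple_path (tree_edges T) (a @ [i, k])"
    using p(1) by (auto simp: simple_path_def ab b successively_append_iff)
  moreover have "hd (a @ [i, k]) = root T" using p(2) by (cases a) (auto simp: ab)
  moreover have "k \<in> nodes T" using e assms(1) by auto
  ultimately have "k \<in> subtree_nodes T i" unfolding subtree_nodes_def
    by (intro CollectI conjI exI[of _ "a @ [i, k]"]) auto
  moreover have "l \<in> subtree_nodes T k" using l p ab b by (auto simp: subtree_nodes_def)
  ultimately show thesis using that e by (auto simp: children_def)
qed

text \<open>\<open>subtree_nodes\<close> asks for some root path through the given node, so the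
  inclusion rests on the absence of cycles: a root path that reaches \<open>k\<close> while avoiding
  \<open>i\<close> would, together with the root path reaching \<open>k\<close> through
  \<open>i\<close>, contain a cycle. Hence the path witnessing \<open>l\<close> below
  \<open>k\<close> passes through \<open>i\<close> as well.\<close>

lemma subtree_nodes_child_subset:
  assumes tree: "is_tree (nodes T) (tree_edges T)" and k: "k \<in> children T i"
  shows "subtree_nodes T k \<subseteq> subtree_nodes T i"
proof
  fix l assume "l \<in> subtree_nodes T k"
  then obtain p where p: "simple_path (tree_edges T) p" "hd p = root T" "last p = l" "k \<in> set p"
    and l: "l \<in> nodes T"
    by (auto simp: subtree_nodes_def)
  have no_cycle: False
    if "simple_path (tree_edges T) q" "length q \<ge> 3" "{last q, hd q} \<in> tree_edges T" for q
    using tree that by (auto simp: is_tree_def)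
  have "i \<in> set p"
  proof (rule ccontr)
    assume ip: "i \<notin> set p"
    from k have e: "{i, k} \<in> tree_edges T" by (auto simp: children_def)
    from p(4) obtain p1 p2 where p12: "p = p1 @ k # p2" by (auto dest: split_list)
    from k obtain s where s: "simple_path (tree_edges T) s" "hd s = root T" "last s = k" "i \<in> set s"
      by (auto simp: children_def subtree_nodes_def)
    from s(4) obtain a b where ab: "s = a @ i # b" by (auto dest: split_list)
    have "i \<noteq> k" using ip p(4) by auto
    then have bne: "b \<noteq> []" using s(3) ab by auto
    \<comment> \<open>A longer piece of the path between \<open>i\<close> and \<open>k\<close> would
      be closed to a cycle by the edge \<open>{i, k}\<close>.\<close>
    have b1: "b = [k]"
    proof (rule ccontr)
      assume "b \<noteq> [k]"
      moreover have "last b = k" using s(3) ab bne by auto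
      ultimately have "length (i # b) \<ge> 3" using bne by (cases b; cases "tl b") auto
      moreover have "simple_path (tree_edges T) (i # b)"
        using s(1) by (auto simp: simple_path_def ab successively_append_iff)
      ultimately show False
        using no_cycle[of "i # b"] e \<open>last b = k\<close> bne by (auto simp: insert_commute)
    qed
    define P where "P = p1 @ [k]"
    have P: "simple_path (tree_edges T) P"
      using p(1) by (auto simp: simple_path_def P_def p12 successively_append_iff)
    have hP: "hd P = root T" using p(2) by (cases p1) (auto simp: P_def p12)
    have iP: "i \<notin> set P" using ip by (auto simp: P_def p12)
    have "hd (a @ [i]) = root T" using s(2) by (cases a) (auto simp: ab)
    then have "root T \<in> set (a @ [i])" by (metis hd_in_set snoc_eq_iff_butlast)
    moreover have "root T \<in> set P" using hP by (metis P_def hd_in_set snoc_eq_iff_butlast)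
    ultimately have "\<exists>x\<in>set (a @ [i]). x \<in> set P" by blast
    from split_list_last_prop[OF this] obtain a1 z a2
      where z: "a @ [i] = a1 @ z # a2" "z \<in> set P" "\<forall>y\<in>set a2. y \<notin> set P" by blast
    have a2: "a2 \<noteq> []" "last a2 = i"
    proof -
      show "a2 \<noteq> []" using z(1,2) iP by (cases a2 rule: rev_cases) auto
      then show "last a2 = i" using z(1) by (metis last_ConsR last_appendR last_snoc list.distinct(1))
    qed
    from z(2) obtain q1 q2 where q: "P = q1 @ z # q2" by (auto dest: split_list)
    have s': "simple_path (tree_edges T) ((a1 @ z # a2) @ [k])"
      using s(1) unfolding z(1)[symmetric] ab b1 by simp
    have "z \<noteq> k" using s' by (auto simp: simple_path_def)
    then have q2: "q2 \<noteq> []" "last q2 = k"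
      using q by (cases q2 rule: rev_cases; auto simp: P_def)+
    have P': "simple_path (tree_edges T) (z # q2)"
      using P by (auto simp: simple_path_def q successively_append_iff)
    \<comment> \<open>Two paths from the root to \<open>k\<close>, one through \<open>i\<close> and one avoiding it, close up from
      their last common vertex \<open>z\<close> before \<open>i\<close>.\<close>
    let ?c = "(z # a2) @ rev q2"
    have "simple_path (tree_edges T) ?c"
      unfolding simple_path_def
    proof (intro conjI)
      show "distinct ?c" using s' P' z(3) q by (auto simp: simple_path_def)
      have "successively (\<lambda>j k. {j, k} \<in> tree_edges T) (z # a2)"
        using s' unfolding simple_path_def successively_append_iff[of _ "a1 @ _"]
          successively_append_iff[of _ a1] by blast
      moreover have "successively (\<lambda>j k. {j, k} \<in> tree_edges T) (rev q2)"
        using P' q2 by (auto simp: simple_path_def insert_commute successively_Cons)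
      moreover have "{last (z # a2), hd (rev q2)} \<in> tree_edges T"
        using a2 q2 e by (auto simp: hd_rev)
      ultimately show "successively (\<lambda>j k. {j, k} \<in> tree_edges T) ?c"
        by (simp only: successively_append_iff) auto
    qed auto
    moreover have "length ?c \<ge> 3" using a2(1) q2(1) by (cases a2; cases q2) auto
    moreover have "{last ?c, hd ?c} \<in> tree_edges T"
      using P' q2 by (cases q2) (auto simp: simple_path_def insert_commute last_rev)
    ultimately show False using no_cycle by blast
  qed
  with p l show "l \<in> subtree_nodes T i" by (auto simp: subtree_nodes_def)
qed

text \<open>Apart from \<open>i\<close> itself, the nodes below \<open>i\<close> are those below its
  only child, and the bag of \<open>i\<close> is contained in the child's bag, so it contributes no
  further vertex.\<close>

lemma lower_vertices_forget:
  assumes tree: "is_tree (nodes T) (tree_edges T)" and fn: "forget_node T i i' w"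
  shows "lower_vertices T i = lower_vertices T i'"
    and "bag T i' \<subseteq> lower_vertices T i'"
proof -
  have ch: "children T i = {i'}" and bag: "bag T i \<subseteq> bag T i'"
    using fn by (auto simp: forget_node_def)
  have edges: "\<Union>(tree_edges T) \<subseteq> nodes T" using tree by (auto simp: is_tree_def)
  have "i' \<in> subtree_nodes T i" using ch by (auto simp: children_def)
  \<comment> \<open>A root path witnessing that \<open>i'\<close> lies below \<open>i\<close> ends
    in \<open>i'\<close> and so passes through it.\<close>
  then have i': "i' \<in> subtree_nodes T i'"
    by (auto simp: subtree_nodes_def simple_path_def intro: last_in_set)
  then show sub: "bag T i' \<subseteq> lower_vertices T i'" by (auto simp: lower_vertices_def)
  show "lower_vertices T i = lower_vertices T i'"
  proof
    show "lower_vertices T i \<subseteq> lower_vertices T i'"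
    proof
      fix v assume "v \<in> lower_vertices T i"
      then obtain l where l: "l \<in> subtree_nodes T i" "v \<in> bag T l" by (auto simp: lower_vertices_def)
      show "v \<in> lower_vertices T i'"
      proof (cases "l = i")
        case True
        then show ?thesis using l bag sub by auto
      next
        case False
        then obtain k where "k \<in> children T i" "l \<in> subtree_nodes T k"
          using l edges subtree_nodes_via_child by metis
        then show ?thesis using l ch by (auto simp: lower_vertices_def)
      qed
    qed
    show "lower_vertices T i' \<subseteq> lower_vertices T i"
      using subtree_nodes_child_subset[OF tree, of i' i] ch by (auto simp: lower_vertices_def)
  qed
qed

section \<open>In-directed forests\<close>

lemma in_forest_iff: "in_forest F \<longleftrightarrow> inj_on arc_tail F \<and> acyclic (arc_rel F)"
  unfolding in_forest_def Uniq_def inj_on_def by blast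

lemma arc_rel_eq_image: "arc_rel F = snd ` F"
  by (force simp: arc_rel_def)

lemma arc_rel_Un: "arc_rel (A \<union> B) = arc_rel A \<union> arc_rel B"
  by (auto simp: arc_rel_eq_image)

lemma Domain_arc_rel: "Domain (arc_rel F) = arc_tail ` F"
  by (force simp: arc_rel_eq_image)

lemma in_forest_subset: "in_forest F \<Longrightarrow> A \<subseteq> F \<Longrightarrow> in_forest A"
  unfolding in_forest_iff arc_rel_eq_image
  by (meson acyclic_subset image_mono inj_on_subset)

text \<open>This justifies the definite description in \<open>root_vector\<close>. Existence: the
  converse of a finite acyclic relation is well-founded, so some vertex reachable from
  \<open>x\<close> has no successor. Uniqueness: with at most one out-arc per vertex, any two
  vertices reachable from \<open>x\<close> are comparable, and comparable sinks coincide.\<close>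

lemma in_forest_ex1_root:
  assumes "finite F" "in_forest F"
  shows "\<exists>!r. (x, r) \<in> (arc_rel F)\<^sup>* \<and> \<not> (\<exists>a\<in>F. arc_tail a = r)"
proof -
  let ?R = "arc_rel F"
  have out: "(\<exists>a\<in>F. arc_tail a = r) \<longleftrightarrow> (\<exists>z. (r, z) \<in> ?R)" for r
    by (force simp: arc_rel_def)
  have sv: "single_valued ?R"
  proof (rule single_valuedI)
    fix u y z assume "(u, y) \<in> ?R" "(u, z) \<in> ?R"
    then obtain e e' where "(e, u, y) \<in> F" "(e', u, z) \<in> F" by (auto simp: arc_rel_def)
    then have "(e, u, y) = (e', u, z)"
      using assms(2) by (intro inj_onD[of arc_tail F]) (auto simp: in_forest_iff)
    then show "y = z" by simp
  qed
  have "wf (?R\<inverse>)"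
    using assms by (intro finite_acyclic_wf_converse) (auto simp: arc_rel_eq_image in_forest_iff)
  then obtain r where r: "r \<in> {y. (x, y) \<in> ?R\<^sup>*}" "\<And>y. (y, r) \<in> ?R\<inverse> \<Longrightarrow> y \<notin> {y. (x, y) \<in> ?R\<^sup>*}"
    by (rule wfE_min[where Q = "{y. (x, y) \<in> ?R\<^sup>*}" and x = x]) auto
  show ?thesis
  proof (rule ex1I)
    show "(x, r) \<in> ?R\<^sup>* \<and> \<not> (\<exists>a\<in>F. arc_tail a = r)"
      unfolding out using r by (auto intro: rtrancl_into_rtrancl)
  next
    fix s assume s: "(x, s) \<in> ?R\<^sup>* \<and> \<not> (\<exists>a\<in>F. arc_tail a = s)"
    have "(r, s) \<in> ?R\<^sup>* \<or> (s, r) \<in> ?R\<^sup>*"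
      using single_valued_confluent[OF sv] r(1) s by blast
    moreover have "\<not> (\<exists>z. (r, z) \<in> ?R)"
      using r by (auto intro: rtrancl_into_rtrancl)
    ultimately show "s = r" using s unfolding out by (metis converse_rtranclE)
  qed
qed

lemma root_vector_reachable:
  assumes "finite F" "in_forest F" "x \<in> L_set G T j"
  shows "(x, root_vector G T j F x) \<in> (arc_rel F)\<^sup>*" "root_vector G T j F x \<notin> arc_tail ` F"
proof -
  have "root_vector G T j F x = (THE r. (x, r) \<in> (arc_rel F)\<^sup>* \<and> \<not> (\<exists>a\<in>F. arc_tail a = r))"
    using assms(3) by (simp only: root_vector_def if_True)
  with theI'[OF in_forest_ex1_root[OF assms(1,2), of x]]
  have "(x, root_vector G T j F x) \<in> (arc_rel F)\<^sup>* \<and> \<not> (\<exists>a\<in>F. arc_tail a = root_vector G T j F x)"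
    by simp
  then show "(x, root_vector G T j F x) \<in> (arc_rel F)\<^sup>*" "root_vector G T j F x \<notin> arc_tail ` F"
    by auto
qed

lemma root_vector_eqI:
  assumes "finite F" "in_forest F" "x \<in> L_set G T j" "(x, r) \<in> (arc_rel F)\<^sup>*" "r \<notin> arc_tail ` F"
  shows "root_vector G T j F x = r"
proof (rule ex1E[OF in_forest_ex1_root[OF assms(1,2), of x]])
  fix s assume s: "\<forall>y. (x, y) \<in> (arc_rel F)\<^sup>* \<and> \<not> (\<exists>a\<in>F. arc_tail a = y) \<longrightarrow> y = s"
  have "y = s" if "(x, y) \<in> (arc_rel F)\<^sup>*" "y \<notin> arc_tail ` F" for y
    using s that by (metis imageI)
  then show ?thesis using root_vector_reachable[OF assms(1-3)] assms(4,5) by metis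
qed

text \<open>Being one's own root amounts to having no out-arc. The later bookkeeping of roots is
  thereby reduced to sets of tails.\<close>

lemma fixed_roots_eq:
  assumes "finite F" "in_forest F"
  shows "fixed_roots G T j F = L_set G T j - arc_tail ` F"
proof -
  have "root_vector G T j F x = x \<longleftrightarrow> x \<notin> arc_tail ` F" if "x \<in> L_set G T j" for x
    using root_vector_eqI[OF assms that rtrancl_refl] root_vector_reachable(2)[OF assms that] by metis
  then show ?thesis by (auto simp: fixed_roots_def)
qed

text \<open>On a cycle with \<open>A\<close> acyclic only the second alternative remains; this is
  how \<open>acyclic_Un_star\<close> finds an arc of \<open>B\<close> on it.\<close>

lemma trancl_Un_cases:
  assumes "(x, y) \<in> (A \<union> B)\<^sup>+"
  shows "(x, y) \<in> A\<^sup>+ \<or> (\<exists>(u, v)\<in>B. (x, u) \<in> (A \<union> B)\<^sup>* \<and> (v, y) \<in> (A \<union> B)\<^sup>*)"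
  using assms
proof (induction rule: trancl_induct)
  case (base y)
  then show ?case by blast
next
  case (step y z)
  then have xy: "(x, y) \<in> (A \<union> B)\<^sup>*" by (simp add: trancl_into_rtrancl)
  from step.hyps(2) step.IH consider "(y, z) \<in> B" | "(y, z) \<in> A" "(x, y) \<in> A\<^sup>+"
    | "(y, z) \<in> A" "\<exists>(u, v)\<in>B. (x, u) \<in> (A \<union> B)\<^sup>* \<and> (v, y) \<in> (A \<union> B)\<^sup>*" by blast
  then show ?case
  proof cases
    case 1
    then show ?thesis using xy by blast
  next
    case 2
    then show ?thesis by (meson trancl_into_trancl)
  next
    case 3
    then show ?thesis using rtrancl_into_rtrancl[of _ y "A \<union> B" z] by blast
  qed
qed

text \<open>A cycle cannot stay inside \<open>A\<close>, so it uses an arc of \<open>B\<close>. One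
  end of that arc is \<open>w\<close>, so the cycle can be read as starting at
  \<open>w\<close>.\<close>

lemma acyclic_Un_star:
  assumes "acyclic A" and B: "\<And>u v. (u, v) \<in> B \<Longrightarrow> u = w \<or> v = w"
    and w: "(w, w) \<notin> (A \<union> B)\<^sup>+"
  shows "acyclic (A \<union> B)"
  unfolding acyclic_def
proof (intro allI notI)
  fix x assume "(x, x) \<in> (A \<union> B)\<^sup>+"
  from trancl_Un_cases[OF this] \<open>acyclic A\<close> obtain u v
    where uv: "(u, v) \<in> B" "(x, u) \<in> (A \<union> B)\<^sup>*" "(v, x) \<in> (A \<union> B)\<^sup>*"
    by (auto simp: acyclic_def)
  then have "(v, u) \<in> (A \<union> B)\<^sup>*" by auto
  then have "(u, u) \<in> (A \<union> B)\<^sup>+" "(v, v) \<in> (A \<union> B)\<^sup>+"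
    using uv(1) by (meson UnI2 rtrancl_into_trancl1 rtrancl_into_trancl2)+
  then show False using B[OF uv(1)] w by auto
qed

text \<open>Only the successors of \<open>x\<close> are placed in \<open>S\<close>, so
  \<open>S\<close> may avoid \<open>x\<close>. With \<open>x = y = w\<close> and
  \<open>w \<notin> S\<close> this excludes a cycle through \<open>w\<close>.\<close>

lemma trancl_stays_in_closed:
  assumes "(x, y) \<in> R\<^sup>+" "\<And>z. (x, z) \<in> R \<Longrightarrow> z \<in> S" "\<And>u v. u \<in> S \<Longrightarrow> (u, v) \<in> R \<Longrightarrow> v \<in> S"
  shows "y \<in> S"
  using assms(1) by (induction rule: trancl_induct) (use assms(2,3) in blast)+

text \<open>Since \<open>L_set\<close> lies inside the bag, confining the roots to it just says that
  every lower vertex outside the bag has an out-arc.\<close>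

lemma FOR_in_iff:
  "F \<in> FOR_in G T j D \<longleftrightarrow>
     F \<subseteq> D \<and> in_forest F \<and> lower_vertices T j - bag T j \<subseteq> arc_tail ` F"
  by (fastforce simp: FOR_in_def forest_roots_def L_set_def)

section \<open>Edges and orientations at a forget node\<close>

lemma card_two_Int_le_1_iff:
  assumes "card A = 2"
  shows "card (A \<inter> S) \<le> 1 \<longleftrightarrow> \<not> A \<subseteq> S"
proof -
  have fin: "finite A" using assms card.infinite by fastforce
  show ?thesis
  proof
    show "card (A \<inter> S) \<le> 1 \<Longrightarrow> \<not> A \<subseteq> S" using assms by (auto simp: Int_absorb2)
    assume "\<not> A \<subseteq> S"
    then have "card (A \<inter> S) < card A" using fin by (intro psubset_card_mono) auto
    then show "card (A \<inter> S) \<le> 1" using assms by simp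
  qed
qed

lemma lower_edges_iff:
  assumes "wf_multigraph G"
  shows "e \<in> lower_edges G T j \<longleftrightarrow>
    e \<in> edges G \<and> ends G e \<subseteq> lower_vertices T j \<and> \<not> ends G e \<subseteq> bag T j"
proof -
  have "card (ends G e) = 2" if "e \<in> edges G" using that assms by (auto simp: wf_multigraph_def)
  then show ?thesis unfolding lower_edges_def using card_two_Int_le_1_iff by blast
qed

lemma orientations_arcD:
  assumes "D \<in> orientations G S" "a \<in> D"
  shows "fst a \<in> S" "ends G (fst a) = {arc_tail a, arc_head a}"
  using assms by (auto simp: orientations_def)

lemma orientations_inj: "D \<in> orientations G S \<Longrightarrow> inj_on fst D"
  unfolding orientations_def inj_on_def mem_Collect_eq Ball_def by (metis (no_types, lifting) case_prodE fst_conv)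

lemma orientations_image: "D \<in> orientations G S \<Longrightarrow> fst ` D = S"
  unfolding orientations_def by (auto simp: image_iff)

lemma orientations_finite: "D \<in> orientations G S \<Longrightarrow> finite S \<Longrightarrow> finite D"
  using orientations_inj orientations_image by (metis finite_image_iff)

lemma orientations_restrict:
  assumes "D \<in> orientations G S" "A \<subseteq> S"
  shows "{a \<in> D. fst a \<in> A} \<in> orientations G A"
proof -
  have "\<exists>!a. a \<in> {a \<in> D. fst a \<in> A} \<and> fst a = e" if "e \<in> A" for e
  proof -
    have "\<exists>!a. a \<in> D \<and> fst a = e" using assms that unfolding orientations_def by blast
    moreover have "(\<lambda>a. a \<in> {a \<in> D. fst a \<in> A} \<and> fst a = e) = (\<lambda>a. a \<in> D \<and> fst a = e)"
      using that by auto
    ultimately show ?thesis by (simp only:)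
  qed
  moreover have "\<forall>(e, u, v)\<in>{a \<in> D. fst a \<in> A}. e \<in> A \<and> ends G e = {u, v}"
    using assms(1) by (auto simp: orientations_def)
  ultimately show ?thesis unfolding orientations_def by blast
qed

lemma orientations_disjoint:
  "D \<in> orientations G A \<Longrightarrow> Q \<in> orientations G B \<Longrightarrow> A \<inter> B = {} \<Longrightarrow> D \<inter> Q = {}"
  by (auto dest: orientations_arcD(1))

lemma charge_Un:
  assumes "finite A" "finite B" "A \<inter> B = {}"
  shows "charge (A \<union> B) x = charge A x + charge B x"
proof -
  have "card {a \<in> A \<union> B. P a} = card {a \<in> A. P a} + card {a \<in> B. P a}" for P
    using assms by (subst card_Un_disjoint[symmetric]) (auto intro: arg_cong[where f = card])
  then show ?thesis by (simp add: charge_def outdeg_def indeg_def)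
qed

text \<open>Each edge between \<open>w\<close> and \<open>x\<close> carries exactly one arc of
  \<open>Q\<close>, and \<open>w \<noteq> x\<close> makes the two directions disjoint. So
  \<open>m - q\<close> is the number of arcs from \<open>x\<close> to \<open>w\<close>.\<close>

lemma out_mult_add_swap:
  assumes "Q \<in> orientations G S" "edges_between G w x \<subseteq> S" "w \<noteq> x"
    and "wf_multigraph G" and S: "S \<subseteq> edges G"
  shows "out_mult Q w x + out_mult Q x w = edge_mult G w x"
proof -
  let ?E = "edges_between G w x"
  have fin: "finite Q"
    using assms(1,4) S by (auto simp: wf_multigraph_def intro: orientations_finite finite_subset)
  have "out_mult Q w x + out_mult Q x w
      = card ({a \<in> Q. arc_tail a = w \<and> arc_head a = x} \<union> {a \<in> Q. arc_tail a = x \<and> arc_head a = w})"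
    unfolding out_mult_def using fin assms(3) by (subst card_Un_disjoint) auto
  also have "{a \<in> Q. arc_tail a = w \<and> arc_head a = x} \<union> {a \<in> Q. arc_tail a = x \<and> arc_head a = w}
      = {a \<in> Q. fst a \<in> ?E}"
    using orientations_arcD[OF assms(1)] S by (force simp: edges_between_def doubleton_eq_iff)
  also have "card \<dots> = card (fst ` {a \<in> Q. fst a \<in> ?E})"
    using orientations_inj[OF assms(1)] by (subst card_image) (auto intro: inj_on_subset)
  also have "fst ` {a \<in> Q. fst a \<in> ?E} = ?E"
    using orientations_image[OF assms(1)] assms(2) by auto
  finally show ?thesis by (simp add: edge_mult_def)
qed

lemma out_mult_posI:
  assumes "finite Q" "a \<in> Q"
  shows "out_mult Q (arc_tail a) (arc_head a) > 0"
  unfolding out_mult_def card_gt_0_iff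
proof
  show "{b \<in> Q. arc_tail b = arc_tail a \<and> arc_head b = arc_head a} \<noteq> {}" using assms(2) by blast
qed (simp add: assms(1))

section \<open>Vertices and edges after forgetting \<open>w\<close>\<close>

locale forget =
  fixes G :: "('v, 'e) multigraph" and T :: "('i, 'v) rooted_decomp"
    and i i' :: 'i and w :: 'v
  assumes wf: "wf_multigraph G"
    and decomp: "rooted_tree_decomposition G T"
    and forget: "forget_node T i i' w"
begin

lemma bag_child: "bag T i' = insert w (bag T i)" and w_notin_bag: "w \<notin> bag T i"
  using forget by (auto simp: forget_node_def)

lemma finite_bag: "finite (bag T i)"
proof -
  have "bag T i \<subseteq> vertices G"
    using decomp forget by (auto simp: rooted_tree_decomposition_def forget_node_def)
  then show ?thesis using wf by (auto simp: wf_multigraph_def intro: finite_subset)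
qed

lemma w_notin_neighbours: "w \<notin> neighbours G w"
  using wf by (force simp: neighbours_def edges_between_def wf_multigraph_def)

lemma lower_vertices_eq: "lower_vertices T i = lower_vertices T i'"
  and bag_child_subset: "bag T i' \<subseteq> lower_vertices T i'"
  using lower_vertices_forget[OF _ forget] decomp by (auto simp: rooted_tree_decomposition_def)

text \<open>Once it has left the bag, \<open>w\<close> takes on the duties of an inner vertex: it
  must be balanced and must have an out-arc in the forest.\<close>

lemma lower_diff: "lower_vertices T i - bag T i = insert w (lower_vertices T i' - bag T i')"
  using lower_vertices_eq bag_child_subset bag_child w_notin_bag by auto

lemma edges_to_iff:
  "e \<in> edges_to G w (bag T i) \<longleftrightarrow> e \<in> edges G \<and> (\<exists>x\<in>bag T i. ends G e = {w, x})"
  by (auto simp: edges_to_def edges_between_def)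

text \<open>A lower edge is one inside the lower vertices but not inside the bag. Shrinking the bag
  therefore adds the edges inside the old bag but not inside the new one; as there are no loops,
  these join \<open>w\<close> to the new bag.\<close>

lemma lower_edges_eq: "lower_edges G T i = lower_edges G T i' \<union> edges_to G w (bag T i)"
  and lower_edges_disjoint: "lower_edges G T i' \<inter> edges_to G w (bag T i) = {}"
proof -
  have to_iff: "e \<in> edges_to G w (bag T i) \<longleftrightarrow> ends G e \<subseteq> bag T i' \<and> \<not> ends G e \<subseteq> bag T i"
    if "e \<in> edges G" for e
  proof -
    from that wf obtain a b where "ends G e = {a, b}" "a \<noteq> b"
      by (auto simp: wf_multigraph_def card_2_iff)
    then show ?thesis using that bag_child w_notin_bag by (auto simp: edges_to_iff doubleton_eq_iff)
  qed
  have sub: "ends G e \<subseteq> bag T i \<Longrightarrow> ends G e \<subseteq> bag T i'"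
    "ends G e \<subseteq> bag T i' \<Longrightarrow> ends G e \<subseteq> lower_vertices T i'" for e
    using bag_child bag_child_subset by auto
  have lower: "e \<in> lower_edges G T i \<longleftrightarrow> e \<in> edges G \<and> ends G e \<subseteq> lower_vertices T i' \<and> \<not> ends G e \<subseteq> bag T i"
    for e by (simp only: lower_edges_iff[OF wf] lower_vertices_eq)
  have edge: "e \<in> edges_to G w (bag T i) \<Longrightarrow> e \<in> edges G" for e
    by (simp add: edges_to_iff)
  show "lower_edges G T i = lower_edges G T i' \<union> edges_to G w (bag T i)"
    using lower lower_edges_iff[OF wf, of _ T i'] to_iff sub edge by (intro set_eqI) (metis UnCI UnE)
  show "lower_edges G T i' \<inter> edges_to G w (bag T i) = {}"
    using lower_edges_iff[OF wf, of _ T i'] to_iff edge by (metis disjoint_iff)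
qed

lemma L_set_eq: "L_set G T i = (L_set G T i' - {w}) \<union> (neighbours G w \<inter> bag T i)"
proof -
  have "(\<exists>e\<in>edges_to G w (bag T i). x \<in> ends G e) \<longleftrightarrow> x \<in> neighbours G w" if "x \<in> bag T i" for x
  proof -
    have "x \<noteq> w" using that w_notin_bag by auto
    then show ?thesis
      using that unfolding neighbours_def edges_between_def edges_to_iff Bex_def by auto
  qed
  then show ?thesis
    unfolding L_set_def lower_edges_eq bag_child using w_notin_bag by blast
qed

end

text \<open>Both parts are merely orientations: balance of \<open>D'\<close> is one side of an
  equivalence proved below and so is not assumed.\<close>

locale forget_split = forget G T i i' w
  for G :: "('v, 'e) multigraph" and T :: "('i, 'v) rooted_decomp"
    and i i' :: 'i and w :: 'v +
  fixes D' Q :: "('v, 'e) arc set"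
  assumes D': "D' \<in> orientations G (lower_edges G T i')"
    and Q: "Q \<in> orientations G (edges_to G w (bag T i))"
begin

lemma finite_D': "finite D'" and finite_Q: "finite Q"
proof -
  have "lower_edges G T i' \<subseteq> edges G" "edges_to G w (bag T i) \<subseteq> edges G"
    by (auto simp: lower_edges_def edges_to_def edges_between_def)
  then show "finite D'" "finite Q" using wf D' Q
    by (meson orientations_finite finite_subset wf_multigraph_def)+
qed

lemma disjoint: "D' \<inter> Q = {}"
  using orientations_disjoint[OF D' Q lower_edges_disjoint] .

lemma D'_arc:
  assumes "a \<in> D'"
  shows "arc_tail a \<in> (lower_vertices T i' - bag T i') \<union> L_set G T i'"
    and "arc_head a \<in> (lower_vertices T i' - bag T i') \<union> L_set G T i'"
  using orientations_arcD[OF D' assms] by (auto simp: lower_edges_def L_set_def)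

lemma Q_arc:
  assumes "a \<in> Q"
  obtains "arc_tail a = w" "arc_head a \<in> bag T i \<inter> neighbours G w"
  | "arc_head a = w" "arc_tail a \<in> bag T i \<inter> neighbours G w"
  using orientations_arcD[OF Q assms] that
  by (auto simp: edges_to_iff neighbours_def edges_between_def doubleton_eq_iff)

section \<open>Charges under the added star\<close>

lemma out_mult_eq:
  "x \<in> bag T i \<Longrightarrow> out_mult Q w x + out_mult Q x w = edge_mult G w x"
  using w_notin_bag
  by (intro out_mult_add_swap[OF Q _ _ wf]) (auto simp: edges_to_def edges_between_def)

text \<open>All arcs of \<open>Q\<close> at \<open>x\<close> have \<open>w\<close> as their other
  end, so \<open>x\<close> has in-degree \<open>q\<close> and out-degree
  \<open>m - q\<close>.\<close>

lemma charge_Q_bag: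
  assumes "x \<in> bag T i"
  shows "charge Q x = int (edge_mult G w x) - 2 * int (out_mult Q w x)"
proof -
  have "{a \<in> Q. arc_tail a = x} = {a \<in> Q. arc_tail a = x \<and> arc_head a = w}"
    "{a \<in> Q. arc_head a = x} = {a \<in> Q. arc_tail a = w \<and> arc_head a = x}"
    using assms w_notin_bag by (auto elim: Q_arc)
  then show ?thesis using out_mult_eq[OF assms]
    by (simp add: charge_def outdeg_def indeg_def out_mult_def)
qed

lemma charge_Q_center:
  "charge Q w = - (\<Sum>x\<in>bag T i. int (edge_mult G w x) - 2 * int (out_mult Q w x))"
proof -
  have "outdeg Q w = card (\<Union>x\<in>bag T i. {a \<in> Q. arc_tail a = w \<and> arc_head a = x})"
    unfolding outdeg_def using w_notin_bag by (intro arg_cong[where f = card]) (auto elim: Q_arc)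
  also have "\<dots> = (\<Sum>x\<in>bag T i. out_mult Q w x)"
    unfolding out_mult_def using finite_bag finite_Q by (subst card_UN_disjoint) auto
  finally have out: "outdeg Q w = (\<Sum>x\<in>bag T i. out_mult Q w x)" .
  have "indeg Q w = card (\<Union>x\<in>bag T i. {a \<in> Q. arc_tail a = x \<and> arc_head a = w})"
    unfolding indeg_def using w_notin_bag by (intro arg_cong[where f = card]) (auto elim: Q_arc)
  also have "\<dots> = (\<Sum>x\<in>bag T i. out_mult Q x w)"
    unfolding out_mult_def using finite_bag finite_Q by (subst card_UN_disjoint) auto
  finally have "charge Q w = (\<Sum>x\<in>bag T i. int (out_mult Q w x) - int (out_mult Q x w))"
    unfolding charge_def out by (simp add: sum_subtractf)
  also have "\<dots> = (\<Sum>x\<in>bag T i. - (int (edge_mult G w x) - 2 * int (out_mult Q w x)))"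
    by (intro sum.cong) (auto simp flip: out_mult_eq)
  finally show ?thesis by (simp only: sum_negf)
qed

lemma charge_Q_outside:
  assumes "x \<notin> bag T i'"
  shows "charge Q x = 0"
proof -
  have "{a \<in> Q. arc_tail a = x} = {}" "{a \<in> Q. arc_head a = x} = {}"
    using assms by (auto simp: bag_child elim: Q_arc)
  then show ?thesis by (simp only: charge_def outdeg_def indeg_def)
qed

lemma charge_join: "charge (D' \<union> Q) x = charge D' x + charge Q x"
  by (rule charge_Un[OF finite_D' finite_Q disjoint])

text \<open>The star has charge zero outside the old bag, so the inner vertices of \<open>i'\<close>
  keep their charge. The only new requirement is balance at \<open>w\<close>, which is the sum
  condition.\<close>

lemma balanced_forget_iff:
  assumes "D' \<union> Q \<in> orientations G (lower_edges G T i)"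
  shows "D' \<union> Q \<in> balanced_orientations G T i \<longleftrightarrow> D' \<in> balanced_orientations G T i' \<and>
    (\<Sum>x\<in>bag T i. int (edge_mult G w x) - 2 * int (out_mult Q w x)) = charge D' w"
proof -
  have eq: "outdeg A v = indeg A v \<longleftrightarrow> charge A v = 0" for A :: "('v, 'e) arc set" and v
    by (simp add: charge_def)
  have outside: "charge (D' \<union> Q) v = charge D' v" if "v \<in> lower_vertices T i' - bag T i'" for v
    using that by (simp add: charge_join charge_Q_outside)
  have center: "charge (D' \<union> Q) w = 0 \<longleftrightarrow>
    (\<Sum>x\<in>bag T i. int (edge_mult G w x) - 2 * int (out_mult Q w x)) = charge D' w"
    unfolding charge_join charge_Q_center by presburger
  have "(\<forall>v\<in>lower_vertices T i' - bag T i'. charge (D' \<union> Q) v = 0) \<longleftrightarrow>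
      (\<forall>v\<in>lower_vertices T i' - bag T i'. charge D' v = 0)"
    by (intro ball_cong refl) (simp only: outside)
  then show ?thesis
    unfolding balanced_orientations_def lower_diff eq mem_Collect_eq ball_simps center
    using assms D' by argo
qed

lemma charge_forget_iff:
  "(\<forall>x\<in>bag T i. charge (D' \<union> Q) x = c x) \<longleftrightarrow>
     (\<forall>x \<in> bag T i - neighbours G w. c x = charge D' x) \<and>
     (\<forall>x \<in> bag T i \<inter> neighbours G w.
        c x = charge D' x - 2 * int (out_mult Q w x) + int (edge_mult G w x))"
proof -
  have "charge (D' \<union> Q) x = charge D' x" if "x \<in> bag T i - neighbours G w" for x
  proof -
    have "edge_mult G w x = 0" using that by (simp add: neighbours_def edge_mult_def)
    then have "out_mult Q w x = 0" using out_mult_eq[of x] that by simp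
    then show ?thesis using that \<open>edge_mult G w x = 0\<close> by (simp add: charge_join charge_Q_bag)
  qed
  moreover have "charge (D' \<union> Q) x
      = charge D' x - 2 * int (out_mult Q w x) + int (edge_mult G w x)" if "x \<in> bag T i" for x
    using that by (simp add: charge_join charge_Q_bag)
  ultimately have "(charge (D' \<union> Q) x = c x) \<longleftrightarrow> (x \<in> bag T i - neighbours G w \<longrightarrow> c x = charge D' x) \<and>
     (x \<in> bag T i \<inter> neighbours G w \<longrightarrow>
        c x = charge D' x - 2 * int (out_mult Q w x) + int (edge_mult G w x))" if "x \<in> bag T i" for x
    using that by (cases "x \<in> neighbours G w") auto
  then show ?thesis by blast
qed

section \<open>Forests at a forget node\<close>

lemma tail_bag_in_L:
  assumes "F' \<subseteq> D'" "x \<in> arc_tail ` F'" "x \<in> bag T i'"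
  shows "x \<in> L_set G T i'"
  using assms D'_arc(1) by blast

lemma root_vector_child:
  assumes "F' \<in> FOR_in G T i' D'" "x \<in> L_set G T i'"
  shows "(x, root_vector G T i' F' x) \<in> (arc_rel F')\<^sup>*"
    and "root_vector G T i' F' x \<notin> arc_tail ` F'"
    and "root_vector G T i' F' x \<in> L_set G T i'"
proof -
  let ?r = "root_vector G T i' F' x"
  have F': "F' \<subseteq> D'" "in_forest F'" "lower_vertices T i' - bag T i' \<subseteq> arc_tail ` F'"
    using assms(1) by (auto simp: FOR_in_iff)
  have "finite F'" using F'(1) finite_D' by (rule finite_subset)
  then show reach: "(x, ?r) \<in> (arc_rel F')\<^sup>*" and sink: "?r \<notin> arc_tail ` F'"
    using root_vector_reachable[OF _ F'(2) assms(2)] by simp_all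
  \<comment> \<open>A root other than \<open>x\<close> is the head of an arc of \<open>F'\<close>.
    It is not a vertex below the bag, since all of those have out-arcs.\<close>
  from reach show "?r \<in> L_set G T i'"
  proof (cases rule: rtranclE)
    case base
    then show ?thesis using assms(2) by simp
  next
    case (step y)
    then obtain e where "(e, y, ?r) \<in> F'" by (auto simp: arc_rel_def)
    then show ?thesis using D'_arc(2)[of "(e, y, ?r)"] F'(1,3) sink by auto
  qed
qed

text \<open>Any cycle of the joined forest would pass through \<open>w\<close>, but a walk leaving
  \<open>w\<close> enters \<open>S\<close> and remains there. In the applications \<open>S\<close>
  is the trace of the old forest from \<open>w\<close>, or from the head \<open>w'\<close> of the
  new arc at \<open>w\<close>.\<close>

lemma acyclic_join_absorbing:
  assumes "in_forest F'" "FQ \<subseteq> Q" and w: "w \<notin> S"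
    and start: "\<And>z. (w, z) \<in> arc_rel (F' \<union> FQ) \<Longrightarrow> z \<in> S"
    and closed: "\<And>u v. u \<in> S \<Longrightarrow> (u, v) \<in> arc_rel (F' \<union> FQ) \<Longrightarrow> v \<in> S"
  shows "acyclic (arc_rel (F' \<union> FQ))"
  unfolding arc_rel_Un
proof (rule acyclic_Un_star)
  show "acyclic (arc_rel F')" using assms(1) by (simp add: in_forest_iff)
  show "u = w \<or> v = w" if "(u, v) \<in> arc_rel FQ" for u v
  proof -
    from that assms(2) obtain e where "(e, u, v) \<in> Q" by (auto simp: arc_rel_def)
    then show ?thesis by (auto elim: Q_arc)
  qed
  show "(w, w) \<notin> (arc_rel F' \<union> arc_rel FQ)\<^sup>+"
    using trancl_stays_in_closed[of w w _ S] start closed w unfolding arc_rel_Un by metis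
qed

section \<open>Arc sets with prescribed pairs of tail and head\<close>

lemma one_arc_per_tails:
  assumes "one_arc_per A P"
  shows "arc_tail ` A = fst ` P"
proof
  show "arc_tail ` A \<subseteq> fst ` P" using assms by (force simp: one_arc_per_def)
  show "fst ` P \<subseteq> arc_tail ` A"
  proof
    fix u assume "u \<in> fst ` P"
    then obtain v where "(u, v) \<in> P" by auto
    then obtain a where "a \<in> A" "arc_tail a = u" using assms unfolding one_arc_per_def by blast
    then show "u \<in> arc_tail ` A" by auto
  qed
qed

lemma one_arc_per_inj:
  assumes "one_arc_per A P" "inj_on fst P"
  shows "inj_on arc_tail A"
proof (rule inj_onI)
  fix a b assume ab: "a \<in> A" "b \<in> A" "arc_tail a = arc_tail b"
  then have P: "(arc_tail a, arc_head a) \<in> P" "(arc_tail b, arc_head b) \<in> P"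
    using assms(1) unfolding one_arc_per_def by blast+
  have "(arc_tail a, arc_head a) = (arc_tail b, arc_head b)"
    by (rule inj_onD[OF assms(2) _ P]) (simp add: ab(3))
  then have "arc_head a = arc_head b" by (rule Pair_inject)
  moreover have "\<exists>!a'. a' \<in> A \<and> arc_tail a' = arc_tail a \<and> arc_head a' = arc_head a"
    using assms(1) P(1) unfolding one_arc_per_def by fastforce
  ultimately show "a = b" using ab by metis
qed

lemma one_arc_perI:
  assumes "inj_on arc_tail A" "P = (\<lambda>a. (arc_tail a, arc_head a)) ` A"
  shows "one_arc_per A P"
  unfolding one_arc_per_def
proof (intro conjI ballI)
  fix p assume "p \<in> P"
  then obtain a where a: "a \<in> A" "p = (arc_tail a, arc_head a)" using assms(2) by auto
  then have "\<exists>!a'. a' \<in> A \<and> arc_tail a' = arc_tail a \<and> arc_head a' = arc_head a"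
    using inj_onD[OF assms(1)] by (intro ex1I[of _ a]) auto
  then show "case p of (u, v) \<Rightarrow> \<exists>!a. a \<in> A \<and> arc_tail a = u \<and> arc_head a = v"
    unfolding a(2) prod.case .
qed (use assms(2) in auto)

lemma out_mult_lt:
  assumes "a \<in> Q" "arc_head a = w" "arc_tail a \<in> bag T i"
  shows "out_mult Q w (arc_tail a) < edge_mult G w (arc_tail a)"
proof -
  have "out_mult Q (arc_tail a) w > 0"
    using out_mult_posI[OF finite_Q assms(1)] assms(2) by simp
  then show ?thesis using out_mult_eq[OF assms(3)] by simp
qed

lemma out_mult_pos:
  assumes "a \<in> Q" "arc_tail a = w"
  shows "out_mult Q w (arc_head a) > 0"
  using out_mult_posI[OF finite_Q assms(1)] assms(2) by simp

text \<open>The inner vertices of \<open>i'\<close> already have out-arcs in \<open>F'\<close>, so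
  only \<open>w\<close> needs one more check; disjoint sets of tails keep out-degrees at most
  one.\<close>

lemma FOR_in_joinI:
  assumes F': "F' \<in> FOR_in G T i' D'" and FQ: "FQ \<subseteq> Q" and w: "w \<in> arc_tail ` (F' \<union> FQ)"
    and P: "one_arc_per FQ P" "inj_on fst P" "fst ` P \<inter> arc_tail ` F' = {}"
    and "acyclic (arc_rel (F' \<union> FQ))"
  shows "F' \<union> FQ \<in> FOR_in G T i (D' \<union> Q)"
proof -
  have "inj_on arc_tail FQ" by (rule one_arc_per_inj[OF P(1,2)])
  moreover have "inj_on arc_tail F'" using F' by (simp add: FOR_in_iff in_forest_iff)
  moreover have "arc_tail ` F' \<inter> arc_tail ` FQ = {}" using P(3) one_arc_per_tails[OF P(1)] by auto
  ultimately have "inj_on arc_tail (F' \<union> FQ)" by (simp only: inj_on_Un) blast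
  then show ?thesis using F' FQ w assms(7) lower_diff
    by (auto simp: FOR_in_iff in_forest_iff)
qed

text \<open>The cases distinguish whether \<open>w\<close> has an out-arc in \<open>F'\<close>. An
  untouched \<open>w\<close> has none but is not in \<open>fixed_roots\<close>, hence the union with
  \<open>U_set\<close>. Excluding the root of \<open>w\<close>, respectively of \<open>w'\<close>,
  from \<open>L\<close> is what prevents cycles.\<close>

lemma FOR_in_forget_iff:
  assumes sub: "F' \<subseteq> D'" "FQ \<subseteq> Q"
  shows "F' \<union> FQ \<in> FOR_in G T i (D' \<union> Q) \<longleftrightarrow>
    F' \<in> FOR_in G T i' D' \<and>
    ((w \<notin> fixed_roots G T i' F' \<union> U_set G T i' \<and>
         (\<exists>L U.
            fixed_roots G T i (F' \<union> FQ) = (fixed_roots G T i' F' - L) \<union> U \<and>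
            L \<subseteq> (fixed_roots G T i' F' \<inter>
                  {x \<in> neighbours G w. out_mult Q w x < edge_mult G w x})
                 - {root_vector G T i' F' w} \<and>
            U_set G T i' \<inter> {x \<in> neighbours G w. out_mult Q w x = edge_mult G w x} \<subseteq> U \<and>
            U \<subseteq> U_set G T i' \<inter> neighbours G w \<and>
            one_arc_per FQ ((L \<union> ((neighbours G w \<inter> U_set G T i') - U)) \<times> {w})))
        \<or>
        (w \<in> fixed_roots G T i' F' \<union> U_set G T i' \<and>
         (\<exists>w' L U.
            fixed_roots G T i (F' \<union> FQ) =
              (fixed_roots G T i' F' - (L \<union> {w})) \<union> U \<union> ({w'} \<inter> U_set G T i') \<and>
            w' \<in> (bag T i \<inter> {x \<in> neighbours G w. out_mult Q w x > 0})
                  - {x \<in> L_set G T i'. root_vector G T i' F' x = w} \<and>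
            L \<subseteq> (fixed_roots G T i' F' \<inter>
                  {x \<in> neighbours G w. out_mult Q w x < edge_mult G w x})
                 - {w, w', root_vector G T i' F' w'} \<and>
            U_set G T i' \<inter> {x \<in> neighbours G w. out_mult Q w x = edge_mult G w x} \<subseteq> U \<and>
            U \<subseteq> U_set G T i' \<inter> neighbours G w \<and>
            one_arc_per FQ
              ((L \<union> ((neighbours G w \<inter> U_set G T i') - (U \<union> {w'}))) \<times> {w} \<union> {(w, w')}))))"
    (is "?lhs \<longleftrightarrow> ?F' \<and> (?case1 \<or> ?case2)")
proof -
  let ?N = "neighbours G w" and ?L' = "L_set G T i'" and ?U' = "U_set G T i'"
  let ?R' = "fixed_roots G T i' F'" and ?X = "bag T i"
  let ?q = "out_mult Q w" and ?m = "edge_mult G w"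
  let ?s = "root_vector G T i' F'"
  have finF': "finite F'" and finFQ: "finite FQ"
    using sub finite_D' finite_Q by (auto intro: finite_subset)
  have LU: "?L' \<union> ?U' = insert w ?X" "?L' \<inter> ?U' = {}"
    using bag_child by (auto simp: U_set_def L_set_def)
  have R': "?R' = ?L' - arc_tail ` F'" if ?F'
    using that finF' by (intro fixed_roots_eq) (simp_all add: FOR_in_iff)
  have U'_no_tail: "?U' \<inter> arc_tail ` F' = {}"
    using tail_bag_in_L[OF sub(1)] by (auto simp: U_set_def)
  have w_tail_iff: "w \<in> ?R' \<union> ?U' \<longleftrightarrow> w \<notin> arc_tail ` F'" if ?F'
    using R'[OF that] LU U'_no_tail by blast
  show ?thesis
  proof
    assume ?lhs
    then have forest: "in_forest (F' \<union> FQ)"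
      and tails: "lower_vertices T i - bag T i \<subseteq> arc_tail ` (F' \<union> FQ)"
      by (auto simp: FOR_in_iff)
    have inj: "inj_on arc_tail F'" "inj_on arc_tail FQ"
      using forest by (auto simp: in_forest_iff inj_on_Un)
    have acyc: "acyclic (arc_rel F' \<union> arc_rel FQ)"
      using forest by (simp add: in_forest_iff arc_rel_Un)
    have "F' \<inter> FQ = {}" using sub disjoint by auto
    then have tails_disjoint: "arc_tail ` F' \<inter> arc_tail ` FQ = {}"
      using forest unfolding in_forest_iff inj_on_Un by blast
    have FQ_arc: "(arc_tail a = w \<and> arc_head a \<in> ?X \<inter> ?N \<and> 0 < ?q (arc_head a)) \<or>
        (arc_head a = w \<and> arc_tail a \<in> ?X \<inter> ?N \<and> ?q (arc_tail a) < ?m (arc_tail a))"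
      if "a \<in> FQ" for a
    proof -
      have a: "a \<in> Q" using that sub(2) by auto
      then show ?thesis
      proof (cases rule: Q_arc)
        case 1
        then show ?thesis using out_mult_pos[OF a 1(1)] by (intro disjI1 conjI)
      next
        case 2
        then show ?thesis using out_mult_lt[OF a 2(1)] by (intro disjI2 conjI) blast+
      qed
    qed
    have tails_FQ: "arc_tail ` FQ \<subseteq> insert w (?X \<inter> ?N)" using FQ_arc by blast
    have F'_for: ?F'
    proof -
      \<comment> \<open>Star arcs start only in the old bag, so vertices below it owe their out-arcs
        to \<open>F'\<close>.\<close>
      have "lower_vertices T i' - bag T i' \<subseteq> arc_tail ` F'"
        using tails tails_FQ unfolding lower_diff bag_child by (auto simp only: image_Un) 
      then show ?thesis
        using sub(1) in_forest_subset[OF forest] by (auto simp: FOR_in_iff)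
    qed
    note root = root_vector_child[OF F'_for]
    have reach: "(x, ?s x) \<in> (arc_rel F' \<union> arc_rel FQ)\<^sup>*" if "x \<in> ?L'" for x
      using root(1)[OF that] by (rule rtrancl_mono[THEN subsetD, rotated]) auto
    \<comment> \<open>\<open>?S\<close> consists of the vertices with an arc of \<open>FQ\<close>
      into \<open>w\<close>. None of them is reachable from \<open>w\<close>, as that would close a
      cycle.\<close>
    let ?S = "arc_tail ` FQ - {w}"
    have S: "?S \<subseteq> ?X \<inter> ?N \<inter> {x. ?q x < ?m x}" using FQ_arc by blast
    have S_arc: "(x, w) \<in> arc_rel FQ" if "x \<in> ?S" for x
    proof -
      from that obtain a where "a \<in> FQ" "arc_tail a = x" "x \<noteq> w" by auto
      then show ?thesis using FQ_arc[of a] by (cases a) (auto simp: arc_rel_def)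
    qed
    have acyclicD: False if "(w, x) \<in> (arc_rel F' \<union> arc_rel FQ)\<^sup>*" "x \<in> ?S" for x
    proof -
      have "(w, w) \<in> (arc_rel F' \<union> arc_rel FQ)\<^sup>+"
        using that(1) S_arc[OF that(2)] by (meson UnI2 rtrancl_into_trancl1)
      then show False using acyc by (simp add: acyclic_def)
    qed
    have RF: "fixed_roots G T i (F' \<union> FQ) = (?L' - {w} \<union> ?N \<inter> ?X) - arc_tail ` F' - arc_tail ` FQ"
      using finF' finFQ forest by (subst fixed_roots_eq) (auto simp: L_set_eq)
    \<comment> \<open>The witnesses: \<open>L\<close> holds the old roots that receive an arc into
      \<open>w\<close>, and \<open>U\<close> the untouched neighbours that do not. As no vertex of
      \<open>?S\<close> has an out-arc in \<open>F'\<close>, each is an old root or untouched, which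
      gives \<open>S_eq\<close>.\<close>
    define L where "L = ?R' \<inter> ?S"
    define U where "U = ?N \<inter> ?U' - ?S"
    have S_eq: "?S = L \<union> (?N \<inter> ?U' - U)"
    proof (rule set_eqI)
      fix x
      have "x \<in> ?L' \<or> x \<in> ?U'" "x \<in> ?N" "x \<notin> arc_tail ` F'" if "x \<in> ?S"
        using that S LU(1) tails_disjoint by blast+
      then show "x \<in> ?S \<longleftrightarrow> x \<in> L \<union> (?N \<inter> ?U' - U)"
        unfolding L_def U_def R'[OF F'_for] by blast
    qed
    have U: "?U' \<inter> {x \<in> ?N. ?q x = ?m x} \<subseteq> U" "U \<subseteq> ?U' \<inter> ?N"
      using S unfolding U_def by auto
    have L: "L \<subseteq> ?R' \<inter> {x \<in> ?N. ?q x < ?m x}"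
      using S unfolding L_def by auto
    have "?case1 \<or> ?case2"
    proof (cases "w \<in> arc_tail ` F'")
      case True
      then have wFQ: "w \<notin> arc_tail ` FQ" using tails_disjoint by blast
      have wL': "w \<in> ?L'" using tail_bag_in_L[OF sub(1) True] bag_child by simp
      have "?s w \<notin> L" using acyclicD[OF reach[OF wL']] by (auto simp: L_def)
      then have "L \<subseteq> (?R' \<inter> {x \<in> ?N. ?q x < ?m x}) - {?s w}" using L by blast
      moreover have "w \<notin> ?R' \<union> ?U'" using True w_tail_iff[OF F'_for] by blast
      moreover have "fixed_roots G T i (F' \<union> FQ) = (?R' - L) \<union> U"
        using wFQ True LU U'_no_tail S tails_disjoint w_notin_neighbours
        unfolding RF R'[OF F'_for] L_def U_def by (intro set_eqI) blast
      moreover have "one_arc_per FQ ((L \<union> (?N \<inter> ?U' - U)) \<times> {w})"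
      proof (rule one_arc_perI[OF inj(2)])
        show "(L \<union> (?N \<inter> ?U' - U)) \<times> {w} = (\<lambda>a. (arc_tail a, arc_head a)) ` FQ"
          unfolding S_eq[symmetric] using wFQ FQ_arc by (fastforce simp: image_iff)
      qed
      ultimately show ?thesis using U
        by - (rule disjI1, rule conjI, assumption, rule exI[of _ L], rule exI[of _ U], intro conjI)
    next
      case False
      then have "w \<in> arc_tail ` FQ" using tails by (auto simp: lower_diff image_Un)
      then obtain a where a: "a \<in> FQ" "arc_tail a = w" by auto
      define w' where "w' = arc_head a"
      have w': "w' \<in> ?X \<inter> {x \<in> ?N. 0 < ?q x}"
        using FQ_arc[OF a(1)] a(2) w_notin_bag by (auto simp: w'_def)
      have ww': "(w, w') \<in> arc_rel F' \<union> arc_rel FQ"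
        using a by (cases a) (auto simp: arc_rel_def w'_def)
      have root_w': "?s x \<noteq> w" if "x \<in> ?L'" "x = w'" for x
      proof
        assume "?s x = w"
        then have "(w, w) \<in> (arc_rel F' \<union> arc_rel FQ)\<^sup>+"
          using reach[OF that(1)] ww' that(2) by (metis rtrancl_into_trancl2)
        then show False using acyc by (simp add: acyclic_def)
      qed
      \<comment> \<open>For an untouched \<open>w'\<close> the default value of
        \<open>root_vector\<close> is \<open>w'\<close> itself, and the walk is empty.\<close>
      have "(w', ?s w') \<in> (arc_rel F' \<union> arc_rel FQ)\<^sup>*"
        using reach by (cases "w' \<in> ?L'") (auto simp: root_vector_def)
      then have notS: "?s w' \<notin> ?S" "w' \<notin> ?S"
        using acyclicD ww' by (meson converse_rtrancl_into_rtrancl r_into_rtrancl)+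
      have "fixed_roots G T i (F' \<union> FQ) = (?R' - (L \<union> {w})) \<union> U \<union> ({w'} \<inter> ?U')"
      proof (rule set_eqI)
        fix x
        have "w \<in> arc_tail ` FQ" "w \<noteq> w'" using a w' w_notin_bag by auto
        moreover have "x \<in> ?L' \<or> x \<in> ?U' \<longleftrightarrow> x = w \<or> x \<in> ?X" using LU(1) by blast
        moreover have "x \<in> ?U' \<Longrightarrow> x \<notin> arc_tail ` F' \<and> x \<notin> ?L'" using LU(2) U'_no_tail by blast
        moreover have "x = w' \<Longrightarrow> x \<in> ?X \<and> x \<in> ?N \<and> x \<notin> arc_tail ` FQ"
          using w' notS(2) \<open>w \<noteq> w'\<close> by blast
        ultimately show "x \<in> fixed_roots G T i (F' \<union> FQ) \<longleftrightarrow>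
            x \<in> (?R' - (L \<union> {w})) \<union> U \<union> ({w'} \<inter> ?U')"
          using w_notin_neighbours unfolding RF R'[OF F'_for] L_def U_def
          by (cases "x = w") (simp_all, blast)
      qed
      moreover have "one_arc_per FQ ((L \<union> (?N \<inter> ?U' - (U \<union> {w'}))) \<times> {w} \<union> {(w, w')})"
      proof (rule one_arc_perI[OF inj(2)])
        \<comment> \<open>Removing \<open>w'\<close> changes nothing: it follows \<open>w\<close>
          and hence has no arc back into \<open>w\<close>.\<close>
        have S': "L \<union> (?N \<inter> ?U' - (U \<union> {w'})) = ?S"
          using S_eq notS(2) by blast
        show "(L \<union> (?N \<inter> ?U' - (U \<union> {w'}))) \<times> {w} \<union> {(w, w')} = (\<lambda>a. (arc_tail a, arc_head a)) ` FQ"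
          unfolding S'
        proof (intro equalityI subsetI)
          fix p assume "p \<in> ?S \<times> {w} \<union> {(w, w')}"
          then consider b where "b \<in> FQ" "arc_tail b \<noteq> w" "p = (arc_tail b, w)" | "p = (w, w')"
            by auto
          then show "p \<in> (\<lambda>a. (arc_tail a, arc_head a)) ` FQ"
          proof cases
            case (1 b)
            then show ?thesis using FQ_arc[of b] by (intro image_eqI[of _ _ b]) auto
          next
            case 2
            then show ?thesis using a by (intro image_eqI[of _ _ a]) (auto simp: w'_def)
          qed
        next
          fix p assume "p \<in> (\<lambda>a. (arc_tail a, arc_head a)) ` FQ"
          then obtain b where b: "b \<in> FQ" "p = (arc_tail b, arc_head b)" by auto
          show "p \<in> ?S \<times> {w} \<union> {(w, w')}"
          proof (cases "arc_tail b = w")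
            case True
            then have "b = a" using inj_onD[OF inj(2)] a b by simp
            then show ?thesis using b a by (simp add: w'_def)
          next
            case False
            then have "arc_tail b \<in> ?S" "arc_head b = w" using b(1) FQ_arc[OF b(1)] by blast+
            then show ?thesis unfolding b(2) by simp
          qed
        qed
      qed
      moreover have "L \<subseteq> (?R' \<inter> {x \<in> ?N. ?q x < ?m x}) - {w, w', ?s w'}"
        using L notS unfolding L_def by blast
      moreover have "w \<in> ?R' \<union> ?U'" using False w_tail_iff[OF F'_for] by blast
      moreover have "w' \<in> ?X \<inter> {x \<in> ?N. 0 < ?q x} - {x \<in> ?L'. ?s x = w}"
        using w' root_w' by blast
      ultimately show ?thesis using U
        by - (rule disjI2, rule conjI, assumption, rule exI[of _ w'], rule exI[of _ L],
          rule exI[of _ U], intro conjI)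
    qed
    with F'_for show "?F' \<and> (?case1 \<or> ?case2)" ..
  next
    assume rhs: "?F' \<and> (?case1 \<or> ?case2)"
    then have F'_for: ?F' ..
    then have F'_forest: "in_forest F'" by (simp add: FOR_in_iff)
    then have acyc: "acyclic (arc_rel F')" by (simp add: in_forest_iff)
    note root = root_vector_child[OF F'_for]
    note R' = R'[OF F'_for]
    have in_tail: "u \<in> arc_tail ` A" if "(u, v) \<in> arc_rel A" for u v and A :: "('v, 'e) arc set"
      using that Domain_arc_rel[of A] by blast
    have unique_sink: "y = ?s x"
      if "x \<in> ?L'" "(x, y) \<in> (arc_rel F')\<^sup>*" "y \<notin> arc_tail ` F'" for x y
      using root_vector_eqI[OF finF' F'_forest that] by simp
    from rhs consider (case1) ?case1 | (case2) ?case2 by blast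
    then show ?lhs
    proof cases
      case case1
      then obtain L U where w: "w \<notin> ?R' \<union> ?U'"
        and L: "L \<subseteq> (?R' \<inter> {x \<in> ?N. ?q x < ?m x}) - {?s w}"
        and one: "one_arc_per FQ ((L \<union> (?N \<inter> ?U' - U)) \<times> {w})" (is "one_arc_per FQ ?P")
        by blast
      have w_tail: "w \<in> arc_tail ` F'" using w w_tail_iff[OF F'_for] by blast
      have wL': "w \<in> ?L'" using tail_bag_in_L[OF sub(1) w_tail] bag_child by simp
      have tails_FQ: "arc_tail ` FQ = L \<union> (?N \<inter> ?U' - U)"
        using one_arc_per_tails[OF one] by simp
      show ?lhs
      proof (rule FOR_in_joinI[OF F'_for sub(2) _ one])
        show "w \<in> arc_tail ` (F' \<union> FQ)" using w_tail by blast
        show "inj_on fst ?P" by (auto simp: inj_on_def)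
        show disj: "fst ` ?P \<inter> arc_tail ` F' = {}"
          using L R' U'_no_tail by auto
        \<comment> \<open>A tail of \<open>FQ\<close> has no out-arc in \<open>F'\<close>, so if
          reached from \<open>w\<close> it is the root of \<open>w\<close>. That root lies in
          \<open>?L'\<close>, hence is not untouched, and it was excluded from
          \<open>L\<close>.\<close>
        have no_tail: "y \<notin> arc_tail ` FQ" if "(w, y) \<in> (arc_rel F')\<^sup>*" for y
        proof
          assume y: "y \<in> arc_tail ` FQ"
          then have "y \<notin> arc_tail ` F'" using disj tails_FQ by auto
          then have "y = ?s w" using unique_sink[OF wL' that] by simp
          then have "y \<in> ?L'" "y \<notin> L" using root(3)[OF wL'] L by auto
          then show False using y LU tails_FQ by blast
        qed
        show "acyclic (arc_rel (F' \<union> FQ))"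
        proof (rule acyclic_join_absorbing[OF F'_forest sub(2)])
          \<comment> \<open>The absorbing set uses nonempty walks, so acyclicity of
            \<open>F'\<close> keeps \<open>w\<close> out of it.\<close>
          show "w \<notin> {y. (w, y) \<in> (arc_rel F')\<^sup>+}" using acyc by (simp add: acyclic_def)
          show "z \<in> {y. (w, y) \<in> (arc_rel F')\<^sup>+}" if "(w, z) \<in> arc_rel (F' \<union> FQ)" for z
            using that no_tail[of w] in_tail[of w z FQ] by (auto simp: arc_rel_Un)
          show "v \<in> {y. (w, y) \<in> (arc_rel F')\<^sup>+}"
            if "u \<in> {y. (w, y) \<in> (arc_rel F')\<^sup>+}" "(u, v) \<in> arc_rel (F' \<union> FQ)" for u v
          proof -
            have "(w, u) \<in> (arc_rel F')\<^sup>+" using that(1) by simp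
            moreover from this have "(u, v) \<notin> arc_rel FQ"
              using no_tail in_tail trancl_into_rtrancl by metis
            then have "(u, v) \<in> arc_rel F'" using that(2) by (simp add: arc_rel_Un)
            ultimately show ?thesis by (simp add: trancl_into_trancl)
          qed
        qed
      qed
    next
      case case2
      then obtain w' L U where w: "w \<in> ?R' \<union> ?U'"
        and w': "w' \<in> ?X \<inter> {x \<in> ?N. 0 < ?q x} - {x \<in> ?L'. ?s x = w}"
        and L: "L \<subseteq> (?R' \<inter> {x \<in> ?N. ?q x < ?m x}) - {w, w', ?s w'}"
        and one: "one_arc_per FQ ((L \<union> (?N \<inter> ?U' - (U \<union> {w'}))) \<times> {w} \<union> {(w, w')})"
          (is "one_arc_per FQ ?P")
        by blast
      have w_tail: "w \<notin> arc_tail ` F'" using w w_tail_iff[OF F'_for] by blast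
      have tails_FQ: "arc_tail ` FQ = insert w (L \<union> (?N \<inter> ?U' - (U \<union> {w'})))"
        using one_arc_per_tails[OF one] by (auto simp: image_Un)
      \<comment> \<open>\<open>F'\<close> has no arc leaving \<open>w\<close>, and among the
        prescribed pairs only \<open>(w, w')\<close> starts at \<open>w\<close>, because
        \<open>w\<close> is not its own neighbour.\<close>
      have heads: "v = w'" if arc: "(w, v) \<in> arc_rel (F' \<union> FQ)" for v
      proof -
        have "(w, v) \<notin> arc_rel F'" using in_tail[of w v F'] w_tail by blast
        then obtain e where "(e, w, v) \<in> FQ" using arc by (auto simp: arc_rel_Un arc_rel_def)
        then have "(w, v) \<in> ?P" using one unfolding one_arc_per_def by fastforce
        then show ?thesis using L w_notin_neighbours by auto
      qed
      have "w \<noteq> w'" using w' w_notin_bag by auto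
      show ?lhs
      proof (rule FOR_in_joinI[OF F'_for sub(2) _ one])
        show "w \<in> arc_tail ` (F' \<union> FQ)" using tails_FQ by (simp add: image_Un)
        show "inj_on fst ?P" using L w_notin_neighbours by (auto simp: inj_on_def)
        show disj: "fst ` ?P \<inter> arc_tail ` F' = {}"
          using L R' U'_no_tail w_tail by auto
        \<comment> \<open>Such a \<open>y\<close> would be a sink of \<open>F'\<close>. If
          \<open>w'\<close> is in \<open>?L'\<close>, it is the root of \<open>w'\<close>, which is
          neither \<open>w\<close> nor in \<open>L\<close>. An untouched \<open>w'\<close> reaches
          only itself and is removed from the prescribed tails. Since \<open>w\<close> is a tail of
          \<open>FQ\<close>, it follows also that \<open>w\<close> is not reached from
          \<open>w'\<close>.\<close>
        have no_tail: "y \<notin> arc_tail ` FQ" if y: "(w', y) \<in> (arc_rel F')\<^sup>*" for y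
        proof
          assume yFQ: "y \<in> arc_tail ` FQ"
          then have sink: "y \<notin> arc_tail ` F'" using disj one_arc_per_tails[OF one] by blast
          show False
          proof (cases "w' \<in> ?L'")
            case True
            then have "y = ?s w'" using unique_sink[OF True y sink] by simp
            then have "y \<in> ?L'" "y \<notin> L" "y \<noteq> w" using root(3)[OF True] L w' True by auto
            then show False using yFQ LU tails_FQ by blast
          next
            case False
            then have "w' \<in> ?U'" using w' LU by blast
            then have "w' \<notin> arc_tail ` F'" using U'_no_tail by blast
            then have "y = w'" using y in_tail by (metis converse_rtranclE)
            moreover have "w' \<notin> L" using L by (simp add: subset_iff) blast
            ultimately show False using yFQ \<open>w \<noteq> w'\<close> unfolding tails_FQ by simp
          qed
        qed
        show "acyclic (arc_rel (F' \<union> FQ))"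
        proof (rule acyclic_join_absorbing[OF F'_forest sub(2)])
          show "w \<notin> {y. (w', y) \<in> (arc_rel F')\<^sup>*}"
            using no_tail[of w] tails_FQ by blast
          show "z \<in> {y. (w', y) \<in> (arc_rel F')\<^sup>*}" if "(w, z) \<in> arc_rel (F' \<union> FQ)" for z
            using heads[OF that] by simp
          show "v \<in> {y. (w', y) \<in> (arc_rel F')\<^sup>*}"
            if "u \<in> {y. (w', y) \<in> (arc_rel F')\<^sup>*}" "(u, v) \<in> arc_rel (F' \<union> FQ)" for u v
          proof -
            have "(w', u) \<in> (arc_rel F')\<^sup>*" using that(1) by simp
            moreover from this have "(u, v) \<notin> arc_rel FQ" using no_tail in_tail by metis
            then have "(u, v) \<in> arc_rel F'" using that(2) by (simp add: arc_rel_Un)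
            ultimately show ?thesis by (simp add: rtrancl_into_rtrancl)
          qed
        qed
      qed
    qed
  qed
qed

end

section \<open>Splitting and rejoining forest Orbs at a forget node\<close>

theorem theorem2:
  fixes G :: "('v, 'e) multigraph" and T :: "('i, 'v) rooted_decomp"
    and i i' :: 'i and w :: 'v
    and D F :: "('v, 'e) arc set" and c :: "'v \<Rightarrow> int"
  assumes "eulerian G"
    and "rooted_tree_decomposition G T"
    and "forget_node T i i' w"
    and "D \<in> orientations G (lower_edges G T i)"
    and "F \<subseteq> D"
  shows "(D, F) \<in> forest_orbs G T i \<and> (\<forall>x\<in>bag T i. charge D x = c x) \<longleftrightarrow>
    (\<exists>D' Q F' FQ.
       D' \<in> balanced_orientations G T i' \<and>
       Q \<in> orientations G (edges_to G w (bag T i)) \<and>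
       D = D' \<union> Q \<and> D' \<inter> Q = {} \<and>
       F' \<in> FOR_in G T i' D' \<and> FQ \<subseteq> Q \<and>
       F = F' \<union> FQ \<and> F' \<inter> FQ = {} \<and>
       (D', F') \<in> forest_orbs G T i' \<and>
       (\<Sum>x\<in>bag T i. int (edge_mult G w x) - 2 * int (out_mult Q w x)) = charge D' w \<and>
       (\<forall>x \<in> bag T i - neighbours G w. c x = charge D' x) \<and>
       (\<forall>x \<in> bag T i \<inter> neighbours G w.
          c x = charge D' x - 2 * int (out_mult Q w x) + int (edge_mult G w x)) \<and>
       ((w \<notin> fixed_roots G T i' F' \<union> U_set G T i' \<and>
         (\<exists>L U.
            fixed_roots G T i F = (fixed_roots G T i' F' - L) \<union> U \<and>
            L \<subseteq> (fixed_roots G T i' F' \<inter>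
                  {x \<in> neighbours G w. out_mult Q w x < edge_mult G w x})
                 - {root_vector G T i' F' w} \<and>
            U_set G T i' \<inter> {x \<in> neighbours G w. out_mult Q w x = edge_mult G w x} \<subseteq> U \<and>
            U \<subseteq> U_set G T i' \<inter> neighbours G w \<and>
            one_arc_per FQ ((L \<union> ((neighbours G w \<inter> U_set G T i') - U)) \<times> {w})))
        \<or>
        (w \<in> fixed_roots G T i' F' \<union> U_set G T i' \<and>
         (\<exists>w' L U.
            fixed_roots G T i F =
              (fixed_roots G T i' F' - (L \<union> {w})) \<union> U \<union> ({w'} \<inter> U_set G T i') \<and>
            w' \<in> (bag T i \<inter> {x \<in> neighbours G w. out_mult Q w x > 0})
                  - {x \<in> L_set G T i'. root_vector G T i' F' x = w} \<and>
            L \<subseteq> (fixed_roots G T i' F' \<inter>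
                  {x \<in> neighbours G w. out_mult Q w x < edge_mult G w x})
                 - {w, w', root_vector G T i' F' w'} \<and>
            U_set G T i' \<inter> {x \<in> neighbours G w. out_mult Q w x = edge_mult G w x} \<subseteq> U \<and>
            U \<subseteq> U_set G T i' \<inter> neighbours G w \<and>
            one_arc_per FQ
              ((L \<union> ((neighbours G w \<inter> U_set G T i') - (U \<union> {w'}))) \<times> {w} \<union> {(w, w')})))))"
proof -
  let ?A = "lower_edges G T i'" and ?B = "edges_to G w (bag T i)"
  interpret forget G T i i' w
    using assms(1-3) by unfold_locales (simp_all add: eulerian_def)
  have split: "forget_split G T i i' w D' Q"
    if "D' \<in> orientations G ?A" "Q \<in> orientations G ?B" for D' Q
    using that by unfold_locales
  show ?thesis
  proof (intro iffI, goal_cases)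
    case 1
    \<comment> \<open>The underlying edge decides the part of each arc; \<open>F\<close> is then
      split along the same lines.\<close>
    define D' Q where "D' = {a \<in> D. fst a \<in> ?A}" and "Q = {a \<in> D. fst a \<in> ?B}"
    have D': "D' \<in> orientations G ?A" and Q: "Q \<in> orientations G ?B"
      unfolding D'_def Q_def by (auto intro: orientations_restrict[OF assms(4)] simp: lower_edges_eq)
    have D: "D = D' \<union> Q"
      using orientations_arcD(1)[OF assms(4)] by (auto simp: D'_def Q_def lower_edges_eq)
    interpret forget_split G T i i' w D' Q by (rule split[OF D' Q])
    define F' FQ where "F' = F \<inter> D'" and "FQ = F \<inter> Q"
    have F: "F = F' \<union> FQ" "F' \<subseteq> D'" "FQ \<subseteq> Q" "F' \<inter> FQ = {}"
      using assms(5) disjoint by (auto simp: D F'_def FQ_def)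
    have "D \<in> balanced_orientations G T i" "F \<in> FOR_in G T i D" "\<forall>x\<in>bag T i. charge D x = c x"
      using 1 by (auto simp: forest_orbs_def)
    \<comment> \<open>The three local equivalences, for balance, forests and charges, turn the
      assumptions into the required conditions; refolding restores \<open>F\<close> in the root
      equations.\<close>
    note bal = this(1)[unfolded D balanced_forget_iff[OF assms(4)[unfolded D]]]
      and forests = this(2)[unfolded D F(1) FOR_in_forget_iff[OF F(2,3)], folded F(1)]
      and charges = this(3)[unfolded D charge_forget_iff]
    have "(D', F') \<in> forest_orbs G T i'" using bal forests by (simp add: forest_orbs_def)
    with bal forests charges Q D disjoint F show ?case
      by (elim conjE) (rule exI[of _ D'], rule exI[of _ Q], rule exI[of _ F'], rule exI[of _ FQ],
        intro conjI; assumption)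
  next
    case 2
    then show ?case
    proof (elim exE, goal_cases)
      case (1 D' Q F' FQ)
      then have D: "D = D' \<union> Q" and F: "F = F' \<union> FQ" and Q: "Q \<in> orientations G ?B"
        and bal: "D' \<in> balanced_orientations G T i'" and for': "F' \<in> FOR_in G T i' D'"
        and FQ: "FQ \<subseteq> Q"
        by - (elim conjE, assumption)+
      have D': "D' \<in> orientations G ?A" using bal by (simp add: balanced_orientations_def)
      have F': "F' \<subseteq> D'" using for' by (simp add: FOR_in_def)
      interpret forget_split G T i i' w D' Q by (rule split[OF D' Q])
      have "D \<in> balanced_orientations G T i"
        using 1 bal assms(4) unfolding D by (subst balanced_forget_iff) blast+
      moreover have "F \<in> FOR_in G T i D"
        using 1 for' unfolding D F FOR_in_forget_iff[OF F' FQ] by (elim conjE) (intro conjI; assumption)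
      moreover have "\<forall>x\<in>bag T i. charge D x = c x"
        using 1 unfolding D charge_forget_iff by (elim conjE) (intro conjI; assumption)
      ultimately show ?case by (simp add: forest_orbs_def)
    qed
  qed
qed

end
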